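(* Let $N\ge2$, $T>0$, $l_1,\dots,l_{N+1}>0$, $m_1,\dots,m_N>0$, and consider the associated finite Krein--Stieltjes string dynamical system described in the context. For $k=1,\dots,N$ let $f_k^T\in\mathcal{F}^T_1$ be the control with $W^Tf_k^T=d_k$, where $d_k=(0,\dots,0,\frac1{m_k},0,\dots,0)$ (nonzero entry at the $k$-th place). Then $f_1^T$ can be found as a solution of the equation $$(C^Tf_1^T)(t)=r(T-t),\qquad 0<t<T,$$ and the controls $f_k^T$ satisfy the system (on $(0,T)$, primes denoting derivatives in $t$) $$\begin{cases}m_1(C^Tf_1^T)''=b_1C^Tf_1^T+a_1C^Tf_2^T,\\ m_k(C^Tf_k^T)''=a_{k-1}C^Tf_{k-1}^T+b_kC^Tf_k^T+a_kC^Tf_{k+1}^T,\quad k=2,\dots,N-1,\\ m_N(C^Tf_N^T)''=a_{N-1}C^Tf_{N-1}^T+b_NC^Tf_N^T.\end{cases}$$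
   Context: All functions and spaces are real. Given $l_1,\dots,l_{N+1}>0$ (distances between masses) and $m_1,\dots,m_N>0$ (point masses), put $a_i=\frac1{l_{i+1}}$ for $i=1,\dots,N-1$ and $b_i=-\frac{l_i+l_{i+1}}{l_il_{i+1}}$ for $i=1,\dots,N$. Let $A$ be the symmetric tridiagonal $N\times N$ matrix with diagonal $b_1,\dots,b_N$ and off-diagonal entries $a_1,\dots,a_{N-1}$, and $M=\operatorname{diag}(m_1,\dots,m_N)$. The dynamical system is $Mu_{tt}=Au+\widetilde f$, $t>0$, $u(0)=u_t(0)=0$, with $u(t)\in\mathbb{R}^N$, $\widetilde f=(f/l_1,0,\dots,0)$, $f\in\mathcal{F}^T:=L_2(0,T)$; its solution is denoted $u^f$. The generalized eigenvalue problem $A\varphi=\lambda M\varphi$ has $N$ distinct negative eigenvalues $\lambda_1,\dots,\lambda_N$; $\varphi_k$ is the eigenvector for $\lambda_k$ with first component $1$, and $\rho_k=(M\varphi_k,\varphi_k)_{\mathbb{R}^N}$. The solution has the form $u^f(t)=\sum_{k=1}^N\frac{1}{l_1\rho_k}\int_0^tf(\tau)\frac{\sin\sqrt{|\lambda_k|}(t-\tau)}{\sqrt{|\lambda_k|}}\,d\tau\,\varphi_k$. The response function is $r(t)=\frac1{l_1}\sum_{k=1}^N\frac{\sin\sqrt{|\lambda_k|}t}{\sqrt{|\lambda_k|}\rho_k}$, so that $u_1^f(t)=\int_0^tr(t-s)f(s)\,ds$. The state space $\mathcal{H}^N$ is $\mathbb{R}^N$ with inner product $(a,b)_{\mathcal{H}^N}=(Ma,b)_{\mathbb{R}^N}$.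 The control operator is $W^T:\mathcal{F}^T\to\mathcal{H}^N$, $W^Tf=u^f(T)$; the connecting operator is $C^T=(W^T)^*W^T:\mathcal{F}^T\to\mathcal{F}^T$ (adjoint with respect to these inner products), i.e. $(C^Tf,g)_{L_2(0,T)}=(Mu^f(T),u^g(T))_{\mathbb{R}^N}$. Finally $\mathcal{F}^T_1=\operatorname{span}\left\{\frac{\sin\sqrt{|\lambda_k|}(T-\cdot)}{\sqrt{|\lambda_k|}}\right\}_{k=1}^N$. The restriction of $W^T$ to $\mathcal{F}^T_1$ is an isomorphism onto $\mathcal{H}^N$, so the controls $f_k^T$ exist and are unique. *)

theory Defs
  imports "HOL-Analysis.Analysis" "Jordan_Normal_Form.Matrix"
begin

unbundle no vec_syntax
unbundle no inner_syntax

text \<open>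
  The data \<open>l\<close>, \<open>m\<close>, \<open>a\<close>, \<open>b\<close> and the spectral data are indexed from 1, as on paper;
  vectors and matrices are indexed from 0, so component \<open>i\<close> of a vector belongs to mass \<open>i + 1\<close>.
\<close>

definition coeff_a :: "(nat \<Rightarrow> real) \<Rightarrow> nat \<Rightarrow> real" where
  "coeff_a l i = 1 / l (i + 1)"

definition coeff_b :: "(nat \<Rightarrow> real) \<Rightarrow> nat \<Rightarrow> real" where
  "coeff_b l i = - (l i + l (i + 1)) / (l i * l (i + 1))"

definition string_mat :: "nat \<Rightarrow> (nat \<Rightarrow> real) \<Rightarrow> real mat" where
  "string_mat N l = mat N N (\<lambda>(i, j).
     if i = j then coeff_b l (i + 1)
     else if j = i + 1 then coeff_a l (i + 1)
     else if i = j + 1 then coeff_a l (j + 1)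
     else 0)"

definition mass_mat :: "nat \<Rightarrow> (nat \<Rightarrow> real) \<Rightarrow> real mat" where
  "mass_mat N m = mat_diag N (\<lambda>i. m (i + 1))"

definition state_inner :: "nat \<Rightarrow> (nat \<Rightarrow> real) \<Rightarrow> real Matrix.vec \<Rightarrow> real Matrix.vec \<Rightarrow> real" where
  "state_inner N m x y = (mass_mat N m *\<^sub>v x) \<bullet> y"

text \<open>
  Elements of \<open>L\<^sub>2(0,T)\<close> are given by representatives; only their values on \<open>(0,T)\<close> up to
  null sets matter.
\<close>

definition L2 :: "real \<Rightarrow> (real \<Rightarrow> real) set" where
  "L2 T = {f. set_borel_measurable lborel {0<..<T} f \<and>
              set_integrable lborel {0<..<T} (\<lambda>t. (f t)\<^sup>2)}"

definition L2_eq :: "real \<Rightarrow> (real \<Rightarrow> real) \<Rightarrow> (real \<Rightarrow> real) \<Rightarrow> bool" where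
  "L2_eq T f g \<longleftrightarrow> (AE t in lborel. t \<in> {0<..<T} \<longrightarrow> f t = g t)"

definition L2_inner :: "real \<Rightarrow> (real \<Rightarrow> real) \<Rightarrow> (real \<Rightarrow> real) \<Rightarrow> real" where
  "L2_inner T f g = (LINT t:{0<..<T}|lborel. f t * g t)"

text \<open>
  As \<open>f\<close> is merely square integrable, \<open>M u\<^sub>t\<^sub>t = A u + (f / l\<^sub>1, 0, \<dots>, 0)\<close> is required almost
  everywhere: \<open>v = u\<^sub>t\<close> exists everywhere and is absolutely continuous, being the integral
  of \<open>w = u\<^sub>t\<^sub>t\<close>.
\<close>

definition is_solution ::
  "nat \<Rightarrow> (nat \<Rightarrow> real) \<Rightarrow> (nat \<Rightarrow> real) \<Rightarrow> real \<Rightarrow> (real \<Rightarrow> real) \<Rightarrow> (real \<Rightarrow> real Matrix.vec) \<Rightarrow> bool"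
where
  "is_solution N l m T f u \<longleftrightarrow>
     (\<forall>t\<in>{0..T}. u t \<in> carrier_vec N) \<and> u 0 = 0\<^sub>v N \<and>
     (\<exists>v w. (\<forall>t\<in>{0..T}. v t \<in> carrier_vec N \<and> w t \<in> carrier_vec N) \<and> v 0 = 0\<^sub>v N \<and>
        (\<forall>i<N. set_integrable lborel {0..T} (\<lambda>t. w t $ i) \<and>
           (\<forall>t\<in>{0..T}. ((\<lambda>s. u s $ i) has_real_derivative v t $ i) (at t within {0..T}) \<and>
                        v t $ i = (LINT s:{0..t}|lborel. w s $ i))) \<and>
        (AE t in lborel. t \<in> {0<..<T} \<longrightarrow>
           mass_mat N m *\<^sub>v w t = string_mat N l *\<^sub>v u t + (f t / l 1) \<cdot>\<^sub>v unit_vec N 0))"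

text \<open>The solution is unique on \<open>[0,T]\<close>; the choice only concerns irrelevant arguments.\<close>

definition string_sol ::
  "nat \<Rightarrow> (nat \<Rightarrow> real) \<Rightarrow> (nat \<Rightarrow> real) \<Rightarrow> real \<Rightarrow> (real \<Rightarrow> real) \<Rightarrow> real \<Rightarrow> real Matrix.vec" where
  "string_sol N l m T f = (SOME u. is_solution N l m T f u)"

definition control_op ::
  "nat \<Rightarrow> (nat \<Rightarrow> real) \<Rightarrow> (nat \<Rightarrow> real) \<Rightarrow> real \<Rightarrow> (real \<Rightarrow> real) \<Rightarrow> real Matrix.vec" where
  "control_op N l m T f = string_sol N l m T f T"

text \<open>
  The adjoint with respect to \<open>L2_inner\<close> and \<open>state_inner\<close>. Its values are determined up to
  \<open>L2_eq\<close>, and the choice picks an arbitrary representative.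
\<close>

definition control_op_adj ::
  "nat \<Rightarrow> (nat \<Rightarrow> real) \<Rightarrow> (nat \<Rightarrow> real) \<Rightarrow> real \<Rightarrow> real Matrix.vec \<Rightarrow> real \<Rightarrow> real" where
  "control_op_adj N l m T x = (SOME h. h \<in> L2 T \<and>
     (\<forall>g\<in>L2 T. L2_inner T h g = state_inner N m x (control_op N l m T g)))"

definition connecting_op ::
  "nat \<Rightarrow> (nat \<Rightarrow> real) \<Rightarrow> (nat \<Rightarrow> real) \<Rightarrow> real \<Rightarrow> (real \<Rightarrow> real) \<Rightarrow> real \<Rightarrow> real" where
  "connecting_op N l m T f = control_op_adj N l m T (control_op N l m T f)"

definition is_gen_eigenvector ::
  "nat \<Rightarrow> (nat \<Rightarrow> real) \<Rightarrow> (nat \<Rightarrow> real) \<Rightarrow> real \<Rightarrow> real Matrix.vec \<Rightarrow> bool" where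
  "is_gen_eigenvector N l m \<mu> x \<longleftrightarrow> x \<in> carrier_vec N \<and> x \<noteq> 0\<^sub>v N \<and>
     string_mat N l *\<^sub>v x = \<mu> \<cdot>\<^sub>v (mass_mat N m *\<^sub>v x)"

text \<open>
  \<open>lam\<close> enumerates the generalized eigenvalues without repetition, in any order; that they
  are negative follows from positivity of \<open>l\<close> and \<open>m\<close>.
\<close>

definition spectral_data ::
  "nat \<Rightarrow> (nat \<Rightarrow> real) \<Rightarrow> (nat \<Rightarrow> real) \<Rightarrow> (nat \<Rightarrow> real) \<Rightarrow> (nat \<Rightarrow> real Matrix.vec) \<Rightarrow> bool" where
  "spectral_data N l m lam \<phi> \<longleftrightarrow>
     bij_betw lam {1..N} {\<mu>. \<exists>x. is_gen_eigenvector N l m \<mu> x} \<and>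
     (\<forall>k\<in>{1..N}. is_gen_eigenvector N l m (lam k) (\<phi> k) \<and> \<phi> k $ 0 = 1)"

definition response ::
  "nat \<Rightarrow> (nat \<Rightarrow> real) \<Rightarrow> (nat \<Rightarrow> real) \<Rightarrow> (nat \<Rightarrow> real) \<Rightarrow> (nat \<Rightarrow> real Matrix.vec) \<Rightarrow> real \<Rightarrow> real" where
  "response N l m lam \<phi> t =
     1 / l 1 * (\<Sum>k=1..N. sin (sqrt \<bar>lam k\<bar> * t) / (sqrt \<bar>lam k\<bar> * state_inner N m (\<phi> k) (\<phi> k)))"

definition F1 :: "nat \<Rightarrow> real \<Rightarrow> (nat \<Rightarrow> real) \<Rightarrow> (real \<Rightarrow> real) set" where
  "F1 N T lam = {f \<in> L2 T. \<exists>c. L2_eq T f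
     (\<lambda>t. \<Sum>k=1..N. c k * (sin (sqrt \<bar>lam k\<bar> * (T - t)) / sqrt \<bar>lam k\<bar>))}"

definition target_state :: "nat \<Rightarrow> (nat \<Rightarrow> real) \<Rightarrow> nat \<Rightarrow> real Matrix.vec" where
  "target_state N m k = (1 / m k) \<cdot>\<^sub>v unit_vec N (k - 1)"

end

theory Submission
  imports Defs "Jordan_Normal_Form.Determinant"
begin

text \<open>
  Everything rests on one formula: component \<open>k\<close> of the state at time \<open>T\<close> is the
  \<open>L\<^sub>2\<close> inner product of the control \<open>g\<close> with \<open>t \<mapsto> G\<^sub>k(T - t)\<close>, where
  \<open>G\<^sub>k(t) = 1/l\<^sub>1 \<Sum>\<^sub>j (\<phi>\<^sub>j)\<^sub>k sin(\<omega>\<^sub>j t) / (\<omega>\<^sub>j \<rho>\<^sub>j)\<close> and \<open>\<omega>\<^sub>j\<^sup>2 = - \<lambda>\<^sub>j\<close>.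
  The target \<open>d\<^sub>k\<close> is chosen so that \<open>(d\<^sub>k, x)\<close> in the state space is the component
  \<open>x\<^sub>k\<close>. Hence the adjoint of the control operator sends \<open>d\<^sub>k\<close> to \<open>G\<^sub>k(T - \<cdot>)\<close>, and this
  function is \<open>C\<^sup>T f\<^sub>k\<close> because \<open>W\<^sup>T f\<^sub>k = d\<^sub>k\<close>. For \<open>k = 1\<close> the normalisation
  \<open>(\<phi>\<^sub>j)\<^sub>1 = 1\<close> turns \<open>G\<^sub>1\<close> into the response function. Differentiating \<open>G\<^sub>k\<close> twice multiplies its
  \<open>j\<close>-th summand by \<open>\<lambda>\<^sub>j\<close>, and \<open>m\<^sub>k \<lambda>\<^sub>j (\<phi>\<^sub>j)\<^sub>k = (A \<phi>\<^sub>j)\<^sub>k\<close> is the combination of neighbouring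
  components that appears in the system.

  The formula is proved by projecting a solution onto the eigenvectors, which are orthogonal for
  the mass matrix; there are \<open>N\<close> of them, so their resolution of the identity
  (\<open>completeness\<close>) recovers \<open>u(T)\<close> from the projections. Each projection solves a scalar
  oscillator equation with a merely integrable right-hand side. Two integrations by parts, one of
  them for an indefinite Lebesgue integral (\<open>integral_by_parts_indefinite\<close>), evaluate it at
  \<open>T\<close> (\<open>LINT_oscillator\<close>). The control operator and its adjoint are choices among
  the solutions and among the representing functions. Existence of a solution is therefore
  established separately (\<open>solution_exists\<close>), and uniqueness of the representing
  function up to null sets is \<open>L2_eqI\<close>.
\<close>

section \<open>The scalar oscillator with integrable forcing\<close>

lemma integrable_tensor:
  fixes h k :: "real \<Rightarrow> real"
  assumes h: "integrable lborel h" and k: "integrable lborel k"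
  shows "integrable (lborel \<Otimes>\<^sub>M lborel) (\<lambda>(x, y). h x * k y)"
proof (rule lborel_pair.Fubini_integrable)
  have [measurable]: "h \<in> borel_measurable lborel" "k \<in> borel_measurable lborel"
    using h k by auto
  show "(\<lambda>(x, y). h x * k y) \<in> borel_measurable (lborel \<Otimes>\<^sub>M lborel)"
    by measurable
  have "integrable lborel (\<lambda>x. \<bar>h x\<bar> * (\<integral>y. \<bar>k y\<bar> \<partial>lborel))"
    using h by (intro integrable_mult_left) auto
  then show "integrable lborel (\<lambda>x. \<integral>y. norm (case (x, y) of (x, y) \<Rightarrow> h x * k y) \<partial>lborel)"
    by (simp add: abs_mult)
  show "AE x in lborel. integrable lborel (\<lambda>y. case (x, y) of (x, y) \<Rightarrow> h x * k y)"
    using k by simp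
qed

lemma LINT_derivative:
  fixes F f :: "real \<Rightarrow> real"
  assumes "a \<le> b" "continuous_on {a..b} f"
    and "\<And>x. x \<in> {a..b} \<Longrightarrow> (F has_real_derivative f x) (at x within {a..b})"
  shows "(LINT x:{a..b}|lborel. f x) = F b - F a"
proof -
  have "(f has_integral F b - F a) {a..b}"
    using assms by (intro fundamental_theorem_of_calculus)
      (auto simp flip: has_real_derivative_iff_has_vector_derivative)
  then show ?thesis
    using set_borel_integral_eq_integral(2)[OF borel_integrable_atLeastAtMost'[OF assms(2)]]
    by (simp add: integral_unique)
qed

text \<open>
  The integral \<open>\<integral>\<^sub>0\<^sup>r h\<close> is differentiable only almost everywhere, so the product rule is not
  at hand. Instead \<open>K s\<close> is written as \<open>- \<integral>\<^sub>s\<^sup>T k\<close>, and Fubini exchanges the two integrations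
  over the triangle \<open>0 \<le> s \<le> r \<le> T\<close>.
\<close>

lemma integral_by_parts_indefinite:
  fixes h K k :: "real \<Rightarrow> real"
  assumes T: "0 \<le> T"
    and h: "set_integrable lborel {0..T} h"
    and k: "continuous_on {0..T} k"
    and K: "\<And>s. s \<in> {0..T} \<Longrightarrow> (K has_real_derivative k s) (at s within {0..T})"
    and KT: "K T = 0"
  shows "(LINT s:{0..T}|lborel. h s * K s) =
    - (LINT r:{0..T}|lborel. k r * (LINT s:{0..r}|lborel. h s))"
proof -
  define F where "F = (\<lambda>(s::real, r::real). (indicator {0..T} s * h s) * (indicator {0..T} r * k r)
     * (indicator {(s, r). s \<le> r} (s, r) :: real))"
  have hi: "integrable lborel (\<lambda>s. indicator {0..T} s * h s)"
    using h by (simp add: set_integrable_def)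
  have ki: "integrable lborel (\<lambda>s. indicator {0..T} s * k s)"
    using borel_integrable_atLeastAtMost'[OF k] by (simp add: set_integrable_def)
  have [measurable]: "(\<lambda>s. indicator {0..T} s * h s) \<in> borel_measurable borel"
     "(\<lambda>s. indicator {0..T} s * k s) \<in> borel_measurable borel"
    using hi ki borel_measurable_integrable by fastforce+
  have Fm: "F \<in> borel_measurable (lborel \<Otimes>\<^sub>M lborel)"
    unfolding F_def by measurable
  have "integrable (lborel \<Otimes>\<^sub>M lborel) F"
    by (rule Bochner_Integration.integrable_bound[OF integrable_tensor[OF hi ki] Fm])
       (auto simp: F_def indicator_def)
  then have Fi: "integrable (lborel \<Otimes>\<^sub>M lborel) (\<lambda>(s, r). F (s, r))"
    by simp
  have inner_r: "(\<integral>r. F (s, r) \<partial>lborel) = - (indicator {0..T} s * (h s * K s))" for s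
  proof (cases "s \<in> {0..T}")
    case True
    have "(\<integral>r. F (s, r) \<partial>lborel) = h s * (LINT r:{s..T}|lborel. k r)"
      using True by (auto simp: F_def set_lebesgue_integral_def indicator_def
          simp flip: Bochner_Integration.integral_mult_right_zero intro!: Bochner_Integration.integral_cong)
    also have "(LINT r:{s..T}|lborel. k r) = K T - K s"
      using True by (intro LINT_derivative) (auto intro: DERIV_subset[OF K] continuous_on_subset[OF k])
    finally show ?thesis
      using True KT by simp
  qed (simp add: F_def)
  have inner_s: "(\<integral>s. F (s, r) \<partial>lborel) = indicator {0..T} r * (k r * (LINT s:{0..r}|lborel. h s))" for r
  proof (cases "r \<in> {0..T}")
    case True
    then show ?thesis
      by (auto simp: F_def set_lebesgue_integral_def indicator_def
          simp flip: Bochner_Integration.integral_mult_right_zero intro!: Bochner_Integration.integral_cong)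
  qed (simp add: F_def)
  have "(\<integral>r. (\<integral>s. F (s, r) \<partial>lborel) \<partial>lborel) = (\<integral>s. (\<integral>r. F (s, r) \<partial>lborel) \<partial>lborel)"
    by (rule lborel_pair.Fubini_integral[OF Fi])
  then show ?thesis
    by (simp add: inner_r inner_s set_lebesgue_integral_def)
qed

text \<open>
  Duhamel's formula for \<open>y'' + w\<^sup>2 y = g\<close>, where \<open>h\<close> is \<open>y''\<close>. The kernel
  \<open>sin (w (T - s)) / w\<close> solves the homogeneous equation and vanishes with slope \<open>-1\<close> at \<open>T\<close>.
  Moving both derivatives of \<open>y\<close> onto it leaves only the boundary value \<open>y T\<close>.
\<close>

lemma LINT_oscillator:
  fixes y v h :: "real \<Rightarrow> real"
  assumes T: "0 \<le> T" and w: "w \<noteq> 0"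
    and h: "set_integrable lborel {0..T} h"
    and y: "\<And>t. t \<in> {0..T} \<Longrightarrow> (y has_real_derivative v t) (at t within {0..T})"
    and y0: "y 0 = 0"
    and v: "\<And>t. t \<in> {0..T} \<Longrightarrow> v t = (LINT s:{0..t}|lborel. h s)"
  shows "y T = (LINT s:{0..T}|lborel. (h s + w\<^sup>2 * y s) * (sin (w * (T - s)) / w))"
proof -
  let ?K = "\<lambda>s. sin (w * (T - s)) / w"
  let ?k = "\<lambda>s. - cos (w * (T - s))"
  have K: "(?K has_real_derivative ?k s) (at s within {0..T})" for s
    using w by (auto intro!: derivative_eq_intros)
  have ycont: "continuous_on {0..T} y"
    by (rule DERIV_continuous_on) (rule y)
  have "continuous_on {0..T} (\<lambda>t. integral {0..t} h)"
    by (rule indefinite_integral_continuous_1) (rule set_borel_integral_eq_integral(1)[OF h])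
  moreover have "v t = integral {0..t} h" if "t \<in> {0..T}" for t
    using that v set_borel_integral_eq_integral(2)[OF set_integrable_subset[OF h, of "{0..t}"]]
    by auto
  ultimately have vcont: "continuous_on {0..T} v"
    by (metis (no_types, lifting) continuous_on_cong)
  have hK: "set_integrable lborel {0..T} (\<lambda>s. h s * ?K s)"
    unfolding set_integrable_def
  proof (rule Bochner_Integration.integrable_bound)
    show "integrable lborel (\<lambda>s. (1 / \<bar>w\<bar>) *\<^sub>R (indicator {0..T} s *\<^sub>R h s))"
      using h by (simp add: set_integrable_def)
    have "(\<lambda>s. indicator {0..T} s *\<^sub>R h s) \<in> borel_measurable borel"
      using h by (auto simp: set_integrable_def dest: borel_measurable_integrable)
    then have "(\<lambda>s. (indicator {0..T} s *\<^sub>R h s) * ?K s) \<in> borel_measurable borel"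
      by (rule borel_measurable_times) measurable
    then show "(\<lambda>s. indicator {0..T} s *\<^sub>R (h s * ?K s)) \<in> borel_measurable lborel"
      by (simp add: mult.assoc)
    show "AE x in lborel. norm (indicator {0..T} x *\<^sub>R (h x * ?K x))
      \<le> norm ((1 / \<bar>w\<bar>) *\<^sub>R indicator {0..T} x *\<^sub>R h x)"
      by (auto simp: indicator_def abs_mult divide_right_mono mult_left_le)
  qed
  have yK: "set_integrable lborel {0..T} (\<lambda>s. w\<^sup>2 * y s * ?K s)"
    by (rule borel_integrable_atLeastAtMost') (intro continuous_intros ycont, use w in auto)
  have kv: "set_integrable lborel {0..T} (\<lambda>s. ?k s * v s)"
    by (rule borel_integrable_atLeastAtMost') (intro continuous_intros vcont)
  \<comment> \<open>This derivative encodes the second integration by parts, with boundary values \<open>0\<close> and \<open>y T\<close>.\<close>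
  have d: "((\<lambda>s. y s * cos (w * (T - s))) has_real_derivative (w\<^sup>2 * y s * ?K s - ?k s * v s))
      (at s within {0..T})" if "s \<in> {0..T}" for s
    using w by (auto intro!: derivative_eq_intros y[OF that] simp: power2_eq_square)
  have "y T = (LINT s:{0..T}|lborel. w\<^sup>2 * y s * ?K s - ?k s * v s)"
    using LINT_derivative[OF T _ d] y0 w
    by (simp add: continuous_intros ycont vcont)
  also have "\<dots> = (LINT s:{0..T}|lborel. w\<^sup>2 * y s * ?K s) - (LINT s:{0..T}|lborel. ?k s * v s)"
    by (rule set_integral_diff(2)[OF yK kv])
  also have "(LINT s:{0..T}|lborel. ?k s * v s) =
      (LINT s:{0..T}|lborel. ?k s * (LINT r:{0..s}|lborel. h r))"
    by (rule set_lebesgue_integral_cong) (auto simp: v)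
  also have "\<dots> = - (LINT s:{0..T}|lborel. h s * ?K s)"
    using integral_by_parts_indefinite[OF T h _ K] by (simp add: continuous_intros)
  also have "(LINT s:{0..T}|lborel. w\<^sup>2 * y s * ?K s) - - (LINT s:{0..T}|lborel. h s * ?K s)
     = (LINT s:{0..T}|lborel. h s * ?K s + w\<^sup>2 * y s * ?K s)"
    by (subst set_integral_add(2)[OF hK yK]) simp
  finally show ?thesis
    by (simp add: algebra_simps)
qed

text \<open>
  The forcing is integrated once before the equation is solved. With \<open>P\<close> the integral of \<open>g\<close>, the
  equation \<open>y'' = g - w\<^sup>2 y\<close> becomes the first-order system \<open>y' = P + q\<close>, \<open>q' = - w\<^sup>2 y\<close>,
  whose forcing \<open>P\<close> is continuous. Its solution \<open>\<integral>\<^sub>0\<^sup>t P(s) cos (w (t - s)) ds\<close> is then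
  differentiable everywhere, and the addition theorem makes it a combination of the
  integrals \<open>C\<close> and \<open>S\<close>.
\<close>

lemma oscillator_exists:
  fixes g :: "real \<Rightarrow> real"
  assumes g: "set_integrable lborel {0..T} g"
  shows "\<exists>y v. y 0 = 0 \<and> v 0 = 0 \<and> continuous_on {0..T} y \<and>
    (\<forall>t\<in>{0..T}. (y has_real_derivative v t) (at t within {0..T}) \<and>
       v t = (LINT s:{0..t}|lborel. g s - w\<^sup>2 * y s))"
proof -
  define P where "P t = integral {0..t} g" for t
  define C where "C t = integral {0..t} (\<lambda>s. P s * cos (w * s))" for t
  define S where "S t = integral {0..t} (\<lambda>s. P s * sin (w * s))" for t
  define y where "y t = cos (w * t) * C t + sin (w * t) * S t" for t
  define q where "q t = w * (cos (w * t) * S t - sin (w * t) * C t)" for t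
  have Pc: "continuous_on {0..T} P"
    unfolding P_def
    by (rule indefinite_integral_continuous_1) (rule set_borel_integral_eq_integral(1)[OF g])
  have C: "(C has_real_derivative P t * cos (w * t)) (at t within {0..T})"
    and S: "(S has_real_derivative P t * sin (w * t)) (at t within {0..T})" if "t \<in> {0..T}" for t
    unfolding C_def S_def using that
    by (auto intro!: integral_has_real_derivative continuous_intros Pc)
  have sc: "sin (w * t) * (P t * sin (w * t)) + cos (w * t) * (P t * cos (w * t)) = P t" for t
  proof -
    have "P t * ((sin (w * t))\<^sup>2 + (cos (w * t))\<^sup>2) = P t"
      by simp
    then show ?thesis
      by (simp only: power2_eq_square distrib_left mult_ac)
  qed
  have y: "(y has_real_derivative P t + q t) (at t within {0..T})" if "t \<in> {0..T}" for t
    unfolding y_def q_def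
    apply (rule derivative_eq_intros C[OF that] S[OF that] refl)+
    using sc[of t] by (simp add: algebra_simps)
  have q: "(q has_real_derivative - (w\<^sup>2 * y t)) (at t within {0..T})" if "t \<in> {0..T}" for t
    unfolding y_def q_def
    apply (rule derivative_eq_intros C[OF that] S[OF that] refl)+
    by (simp add: algebra_simps power2_eq_square)
  have yc: "continuous_on {0..T} y"
    by (rule DERIV_continuous_on) (rule y)
  have z: "P 0 = 0" "C 0 = 0" "S 0 = 0"
    by (simp_all add: P_def C_def S_def)
  have "P t + q t = (LINT s:{0..t}|lborel. g s - w\<^sup>2 * y s)" if t: "t \<in> {0..T}" for t
  proof -
    have sub: "{0..t} \<subseteq> {0..T}" using t by auto
    have gt: "set_integrable lborel {0..t} g"
      by (rule set_integrable_subset[OF g]) (use sub in auto)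
    have yt: "continuous_on {0..t} (\<lambda>s. - (w\<^sup>2 * y s))"
      by (intro continuous_intros continuous_on_subset[OF yc sub])
    have "(LINT s:{0..t}|lborel. - (w\<^sup>2 * y s)) = q t - q 0"
      using t sub by (intro LINT_derivative yt) (auto intro!: DERIV_subset[OF q])
    then have "(LINT s:{0..t}|lborel. g s + - (w\<^sup>2 * y s)) = P t + q t"
      using set_integral_add(2)[OF gt borel_integrable_atLeastAtMost'[OF yt]]
        set_borel_integral_eq_integral(2)[OF gt] z by (simp add: q_def P_def)
    then show ?thesis by simp
  qed
  moreover have "y 0 = 0" "q 0 = 0"
    using z by (simp_all add: y_def q_def)
  ultimately show ?thesis
    using y yc z by - (rule exI[of _ y], rule exI[of _ "\<lambda>t. P t + q t"], simp)
qed

section \<open>The stiffness matrix and its eigenvectors\<close>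

lemma string_mat_carrier [simp]: "string_mat N l \<in> carrier_mat N N"
  by (simp add: string_mat_def)

lemma mass_mat_carrier [simp]: "mass_mat N m \<in> carrier_mat N N"
  by (simp add: mass_mat_def)

lemma dim_string_mat [simp]: "dim_row (string_mat N l) = N" "dim_col (string_mat N l) = N"
  by (simp_all add: string_mat_def)

lemma dim_mass_mat [simp]: "dim_row (mass_mat N m) = N" "dim_col (mass_mat N m) = N"
  by (simp_all add: mass_mat_def mat_diag_def)

lemma mass_mat_mult_index:
  assumes "x \<in> carrier_vec N" "i < N"
  shows "(mass_mat N m *\<^sub>v x) $ i = m (i + 1) * x $ i"
proof -
  have "(mass_mat N m *\<^sub>v x) $ i = (\<Sum>j\<in>{0..<N}. (if i = j then m (i + 1) else 0) * x $ j)"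
    using assms by (auto simp: mass_mat_def mat_diag_def scalar_prod_def intro!: sum.cong)
  also have "\<dots> = (\<Sum>j\<in>{0..<N}. if i = j then m (i + 1) * x $ j else 0)"
    by (rule sum.cong) auto
  finally show ?thesis
    using assms by simp
qed

lemma state_inner_sum:
  assumes "x \<in> carrier_vec N" "y \<in> carrier_vec N"
  shows "state_inner N m x y = (\<Sum>i<N. m (i + 1) * x $ i * y $ i)"
  using assms by (auto simp: state_inner_def scalar_prod_def mass_mat_mult_index lessThan_atLeast0
      simp del: index_mult_mat_vec intro!: sum.cong)

lemma string_mat_mult_index:
  assumes x: "x \<in> carrier_vec N" and i: "i < N"
  shows "(string_mat N l *\<^sub>v x) $ i =
    (if i = 0 then 0 else coeff_a l i * x $ (i - 1)) + coeff_b l (i + 1) * x $ i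
     + (if i + 1 < N then coeff_a l (i + 1) * x $ (i + 1) else 0)"
proof -
  have "(string_mat N l *\<^sub>v x) $ i = (\<Sum>j\<in>{0..<N}. (if i = j then coeff_b l (i + 1) * x $ j else 0)
      + (if i + 1 = j then coeff_a l (i + 1) * x $ j else 0)
      + (if j = i - 1 then (if i = 0 then 0 else coeff_a l i * x $ j) else 0))"
    using assms by (auto simp: string_mat_def scalar_prod_def intro!: sum.cong)
  also have "\<dots> = (if i = 0 then 0 else coeff_a l i * x $ (i - 1)) + coeff_b l (i + 1) * x $ i
     + (if i + 1 < N then coeff_a l (i + 1) * x $ (i + 1) else 0)"
    using i by (auto simp: sum.distrib)
  finally show ?thesis .
qed

lemma string_mat_symmetric: "transpose_mat (string_mat N l) = string_mat N l"
  by (rule eq_matI) (auto simp: string_mat_def)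

lemma string_mat_self_adjoint:
  assumes "x \<in> carrier_vec N" "y \<in> carrier_vec N"
  shows "(string_mat N l *\<^sub>v x) \<bullet> y = x \<bullet> (string_mat N l *\<^sub>v y)"
  using transpose_vec_mult_scalar[OF string_mat_carrier, of y N x l] assms
  by (simp add: string_mat_symmetric)

lemma mass_mat_self_adjoint:
  assumes "x \<in> carrier_vec N" "y \<in> carrier_vec N"
  shows "(mass_mat N m *\<^sub>v x) \<bullet> y = x \<bullet> (mass_mat N m *\<^sub>v y)"
  using assms
  by (auto simp: scalar_prod_def mass_mat_mult_index simp del: index_mult_mat_vec intro!: sum.cong)

text \<open>
  Extend \<open>x\<close> by \<open>0\<close> at both fixed ends of the string. The eigenvector equation says that the slope
  jumps by \<open>\<mu> m\<^sub>i x\<^sub>i\<close> at mass \<open>i\<close>. If \<open>\<mu> \<ge> 0\<close>, a string that starts with positive slope bends only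
  upwards and never returns to \<open>0\<close> at the right end.
\<close>

lemma eigenvalue_negative:
  assumes l: "\<forall>i\<in>{1..N+1}. l i > 0" and m: "\<forall>i\<in>{1..N}. m i > 0" and N: "N \<ge> 1"
    and ev: "is_gen_eigenvector N l m \<mu> x" and x0: "x $ 0 = 1"
  shows "\<mu> < 0"
proof (rule ccontr)
  assume "\<not> \<mu> < 0"
  then have \<mu>: "\<mu> \<ge> 0" by simp
  have x: "x \<in> carrier_vec N"
    and eq: "string_mat N l *\<^sub>v x = \<mu> \<cdot>\<^sub>v (mass_mat N m *\<^sub>v x)"
    using ev by (auto simp: is_gen_eigenvector_def)
  define p where "p i = (if i = 0 \<or> i = N + 1 then 0 else x $ (i - 1))" for i
  have step: "(p (i + 1) - p i) / l (i + 1) = (p i - p (i - 1)) / l i + \<mu> * m i * p i"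
    if i: "i \<in> {1..N}" for i
  proof -
    have lp: "l i > 0" "l (i + 1) > 0"
      using l i by auto
    have "(string_mat N l *\<^sub>v x) $ (i - 1) = \<mu> * m i * x $ (i - 1)"
      using i x by (cases i) (simp_all add: eq mass_mat_mult_index del: index_mult_mat_vec)
    moreover have "(string_mat N l *\<^sub>v x) $ (i - 1)
        = p (i - 1) / l i + coeff_b l i * p i + p (i + 1) / l (i + 1)"
      using i x by (auto simp: string_mat_mult_index p_def coeff_a_def simp del: index_mult_mat_vec)
    moreover have "p i = x $ (i - 1)"
      using i by (simp add: p_def)
    ultimately have "p (i - 1) / l i + coeff_b l i * p i + p (i + 1) / l (i + 1) = \<mu> * m i * p i"
      by simp
    moreover have "coeff_b l i * p i = - (p i / l i) - p i / l (i + 1)"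
    proof -
      have "coeff_b l i = - (1 / l i) - 1 / l (i + 1)"
        using lp by (simp add: coeff_b_def field_simps)
      then show ?thesis
        by (simp add: left_diff_distrib)
    qed
    ultimately show ?thesis
      by (simp add: diff_divide_distrib)
  qed
  have grow: "i \<le> N \<Longrightarrow> p (i + 1) > 0 \<and> p (i + 1) \<ge> p i" for i
  proof (induction i)
    case 0
    then show ?case using x0 N by (simp add: p_def)
  next
    case (Suc i)
    then have IH: "p (i + 1) > 0" "p (i + 1) \<ge> p i" by auto
    have pos: "l (i + 1) > 0" "l (i + 2) > 0" "m (i + 1) > 0"
      using l m Suc.prems by auto
    have "(p (i + 2) - p (i + 1)) / l (i + 2) = (p (i + 1) - p i) / l (i + 1) + \<mu> * m (i + 1) * p (i + 1)"
      using step[of "i + 1"] Suc.prems by simp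
    also have "\<dots> \<ge> 0"
      using IH pos \<mu> by (intro add_nonneg_nonneg divide_nonneg_nonneg mult_nonneg_nonneg) auto
    finally have "p (i + 2) \<ge> p (i + 1)"
      using pos by (simp add: zero_le_divide_iff)
    then show ?case using IH by simp
  qed
  have "p (N + 1) > 0"
    using grow[of N] by simp
  then show False
    by (simp add: p_def)
qed

locale krein_string =
  fixes N :: nat and l m lam :: "nat \<Rightarrow> real" and \<phi> :: "nat \<Rightarrow> real Matrix.vec"
  assumes N_pos: "N \<ge> 1"
    and l_pos: "\<forall>i\<in>{1..N+1}. l i > 0"
    and m_pos: "\<forall>i\<in>{1..N}. m i > 0"
    and spectral: "spectral_data N l m lam \<phi>"
begin

abbreviation \<rho> :: "nat \<Rightarrow> real" where "\<rho> j \<equiv> state_inner N m (\<phi> j) (\<phi> j)"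

abbreviation \<omega> :: "nat \<Rightarrow> real" where "\<omega> j \<equiv> sqrt \<bar>lam j\<bar>"

lemma l1_pos: "l 1 > 0" using l_pos by simp

context fixes j assumes j: "j \<in> {1..N}" begin

lemma eigenvector: "is_gen_eigenvector N l m (lam j) (\<phi> j)"
  and first_component: "\<phi> j $ 0 = 1"
  and eigenvector_carrier: "\<phi> j \<in> carrier_vec N"
  and eigenvector_eq: "string_mat N l *\<^sub>v \<phi> j = lam j \<cdot>\<^sub>v (mass_mat N m *\<^sub>v \<phi> j)"
  using spectral j by (auto simp: spectral_data_def is_gen_eigenvector_def)

lemma eigenvector_component:
  "i < N \<Longrightarrow> (string_mat N l *\<^sub>v \<phi> j) $ i = lam j * (m (i + 1) * \<phi> j $ i)"
  using mass_mat_mult_index[OF eigenvector_carrier, of i m]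
  by (simp add: eigenvector_eq del: index_mult_mat_vec)

lemma lam_neg: "lam j < 0"
  by (rule eigenvalue_negative[OF l_pos m_pos N_pos eigenvector first_component])

lemma \<omega>_squared: "(\<omega> j)\<^sup>2 = - lam j" and \<omega>_nonzero: "\<omega> j \<noteq> 0"
  using lam_neg by auto

lemma \<rho>_pos: "\<rho> j > 0"
proof -
  have nonneg: "0 \<le> m (i + 1) * \<phi> j $ i * \<phi> j $ i" if "i < N" for i
    using m_pos that mult_nonneg_nonneg[OF less_imp_le zero_le_square, of "m (i + 1)" "\<phi> j $ i"]
    by (simp add: mult.assoc)
  have "0 < m (0 + 1) * \<phi> j $ 0 * \<phi> j $ 0"
    using m_pos N_pos by (simp add: first_component)
  also have "\<dots> \<le> (\<Sum>i<N. m (i + 1) * \<phi> j $ i * \<phi> j $ i)"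
    using N_pos nonneg by (intro member_le_sum[where f = "\<lambda>i. m (i + 1) * \<phi> j $ i * \<phi> j $ i"]) auto
  finally show ?thesis
    by (simp add: state_inner_sum[OF eigenvector_carrier eigenvector_carrier])
qed

end

lemma eigenvectors_orthogonal:
  assumes j: "j \<in> {1..N}" and k: "k \<in> {1..N}" and "j \<noteq> k"
  shows "state_inner N m (\<phi> j) (\<phi> k) = 0"
proof -
  have "inj_on lam {1..N}"
    using spectral unfolding spectral_data_def bij_betw_def by blast
  then have "lam j \<noteq> lam k"
    using assms by (meson inj_onD)
  have c: "\<phi> j \<in> carrier_vec N" "\<phi> k \<in> carrier_vec N"
    using j k by (simp_all add: eigenvector_carrier)
  have M: "mass_mat N m *\<^sub>v \<phi> j \<in> carrier_vec N" "mass_mat N m *\<^sub>v \<phi> k \<in> carrier_vec N"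
    using c mult_mat_vec_carrier mass_mat_carrier by blast+
  have "lam j * state_inner N m (\<phi> j) (\<phi> k) = (string_mat N l *\<^sub>v \<phi> j) \<bullet> \<phi> k"
    using c M by (simp add: eigenvector_eq[OF j] state_inner_def)
  also have "\<dots> = \<phi> j \<bullet> (string_mat N l *\<^sub>v \<phi> k)"
    by (rule string_mat_self_adjoint[OF c])
  also have "\<dots> = lam k * (\<phi> j \<bullet> (mass_mat N m *\<^sub>v \<phi> k))"
    using c M by (simp add: eigenvector_eq[OF k])
  also have "\<dots> = lam k * state_inner N m (\<phi> j) (\<phi> k)"
    by (simp add: state_inner_def mass_mat_self_adjoint[OF c])
  finally show ?thesis
    using \<open>lam j \<noteq> lam k\<close> by simp
qed

text \<open>
  Orthogonality says that the matrix of normalised rows \<open>M \<phi>\<^sub>j / \<rho>\<^sub>j\<close> is a left inverse of the matrix of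
  columns \<open>\<phi>\<^sub>j\<close>. Both are square, as there are \<open>N\<close> eigenvalues, so it is also a right inverse.
\<close>

lemma completeness:
  assumes "i < N" "k < N"
  shows "(\<Sum>j=1..N. \<phi> j $ k * \<phi> j $ i / \<rho> j) * m (i + 1) = (if i = k then 1 else 0)"
proof -
  define X where "X = Matrix.mat N N (\<lambda>(j, i). m (i + 1) * \<phi> (j + 1) $ i / \<rho> (j + 1))"
  define Y where "Y = Matrix.mat N N (\<lambda>(i, j). \<phi> (j + 1) $ i)"
  have XY_carrier: "X \<in> carrier_mat N N" "Y \<in> carrier_mat N N"
    by (simp_all add: X_def Y_def)
  have "X * Y = 1\<^sub>m N"
  proof (rule eq_matI)
    fix r s assume "r < dim_row (1\<^sub>m N :: real mat)" "s < dim_col (1\<^sub>m N :: real mat)"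
    then have rs: "r < N" "s < N" by auto
    then have in_range: "r + 1 \<in> {1..N}" "s + 1 \<in> {1..N}" by auto
    have "(X * Y) $$ (r, s)
        = (\<Sum>i<N. m (i + 1) * \<phi> (r + 1) $ i * \<phi> (s + 1) $ i) / \<rho> (r + 1)"
      using rs by (simp add: X_def Y_def scalar_prod_def lessThan_atLeast0 sum_divide_distrib)
    also have "\<dots> = state_inner N m (\<phi> (r + 1)) (\<phi> (s + 1)) / \<rho> (r + 1)"
      using in_range by (simp add: state_inner_sum eigenvector_carrier)
    also have "\<dots> = (if r = s then 1 else 0)"
      using \<rho>_pos[OF in_range(1)] eigenvectors_orthogonal[OF in_range] by (cases "r = s") simp_all
    finally show "(X * Y) $$ (r, s) = 1\<^sub>m N $$ (r, s)"
      using rs by simp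
  qed (simp_all add: X_def Y_def)
  then have "Y * X = 1\<^sub>m N"
    by (rule mat_mult_left_right_inverse[OF XY_carrier])
  then have "(Y * X) $$ (k, i) = (if i = k then 1 else 0)"
    using assms by auto
  moreover have "(Y * X) $$ (k, i) = (\<Sum>j<N. \<phi> (Suc j) $ k * (m (i + 1) * \<phi> (Suc j) $ i / \<rho> (Suc j)))"
    using assms by (simp add: X_def Y_def scalar_prod_def lessThan_atLeast0)
  moreover have "\<dots> = (\<Sum>j=1..N. \<phi> j $ k * \<phi> j $ i / \<rho> j) * m (i + 1)"
    unfolding sum_distrib_right by (simp add: sum.atLeast1_atMost_eq mult_ac)
  ultimately show ?thesis
    by simp
qed

end

section \<open>Square-integrable functions\<close>

lemma L2_measurable: "f \<in> L2 T \<Longrightarrow> (\<lambda>t. indicator {0<..<T} t * f t) \<in> borel_measurable borel"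
  by (simp add: L2_def set_borel_measurable_def)

lemma L2_product_integrable:
  assumes f: "f \<in> L2 T" and g: "g \<in> L2 T"
  shows "set_integrable lborel {0<..<T} (\<lambda>t. f t * g t)"
  unfolding set_integrable_def
proof (rule Bochner_Integration.integrable_bound)
  show "integrable lborel (\<lambda>t. indicator {0<..<T} t *\<^sub>R (f t)\<^sup>2 + indicator {0<..<T} t *\<^sub>R (g t)\<^sup>2)"
    using f g by (intro Bochner_Integration.integrable_add) (auto simp: L2_def set_integrable_def)
  have "(\<lambda>t. (indicator {0<..<T} t * f t) * (indicator {0<..<T} t * g t)) \<in> borel_measurable borel"
    by (intro borel_measurable_times L2_measurable f g)
  moreover have "(indicator {0<..<T} t * f t) * (indicator {0<..<T} t * g t)
      = indicator {0<..<T} t *\<^sub>R (f t * g t)" for t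
    by (simp add: indicator_def)
  ultimately show "(\<lambda>t. indicator {0<..<T} t *\<^sub>R (f t * g t)) \<in> borel_measurable lborel"
    by simp
  have "\<bar>a * b\<bar> \<le> a\<^sup>2 + b\<^sup>2" for a b :: real
    using sum_squares_bound[of "\<bar>a\<bar>" "\<bar>b\<bar>"] mult_nonneg_nonneg[OF abs_ge_zero[of a] abs_ge_zero[of b]]
    unfolding abs_mult power2_abs by linarith
  then show "AE t in lborel. norm (indicator {0<..<T} t *\<^sub>R (f t * g t))
      \<le> norm (indicator {0<..<T} t *\<^sub>R (f t)\<^sup>2 + indicator {0<..<T} t *\<^sub>R (g t)\<^sup>2)"
    by (auto simp: indicator_def)
qed

lemma L2_diff:
  assumes f: "f \<in> L2 T" and g: "g \<in> L2 T"
  shows "(\<lambda>t. f t - g t) \<in> L2 T"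
proof -
  have "(\<lambda>t. indicator {0<..<T} t * f t - indicator {0<..<T} t * g t) \<in> borel_measurable borel"
    by (intro borel_measurable_diff L2_measurable f g)
  then have "set_borel_measurable lborel {0<..<T} (\<lambda>t. f t - g t)"
    by (simp add: set_borel_measurable_def right_diff_distrib)
  moreover have "set_integrable lborel {0<..<T} (\<lambda>t. (f t * f t - f t * g t) - (g t * f t - g t * g t))"
    by (intro set_integral_diff L2_product_integrable f g)
  then have "set_integrable lborel {0<..<T} (\<lambda>t. (f t - g t)\<^sup>2)"
    by (simp add: power2_eq_square algebra_simps)
  ultimately show ?thesis by (simp add: L2_def)
qed

lemma L2_continuous:
  assumes "continuous_on {0..T} f"
  shows "f \<in> L2 T"
proof -
  have "set_integrable lborel {0<..<T} h" if "continuous_on {0..T} h" for h :: "real \<Rightarrow> real"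
    by (rule set_integrable_subset[OF borel_integrable_atLeastAtMost'[OF that]]) auto
  from this[OF assms] this[of "\<lambda>t. (f t)\<^sup>2"] show ?thesis
    using assms by (auto simp: L2_def set_integrable_def set_borel_measurable_def intro!: continuous_intros)
qed

lemma L2_integrable:
  assumes "f \<in> L2 T"
  shows "set_integrable lborel {0<..<T} f"
  using L2_product_integrable[OF assms L2_continuous[of T "\<lambda>_. 1"]] by simp

text \<open>The difference of the two functions is itself a legitimate test function.\<close>

lemma L2_eqI:
  assumes h: "h \<in> L2 T" and k: "k \<in> L2 T"
    and eq: "\<And>g. g \<in> L2 T \<Longrightarrow> L2_inner T h g = L2_inner T k g"
  shows "L2_eq T h k"
proof -
  let ?d = "\<lambda>t. h t - k t"
  have d: "?d \<in> L2 T" by (rule L2_diff[OF h k])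
  have "(LINT t:{0<..<T}|lborel. (?d t)\<^sup>2) = (LINT t:{0<..<T}|lborel. h t * ?d t - k t * ?d t)"
    by (simp add: power2_eq_square algebra_simps)
  also have "\<dots> = L2_inner T h ?d - L2_inner T k ?d"
    unfolding L2_inner_def
    by (rule set_integral_diff(2)) (intro L2_product_integrable h k d)+
  finally have "(LINT t:{0<..<T}|lborel. (?d t)\<^sup>2) = 0"
    using eq[OF d] by simp
  moreover have "integrable lborel (\<lambda>t. indicator {0<..<T} t *\<^sub>R (?d t)\<^sup>2)"
    using d by (simp add: L2_def set_integrable_def)
  ultimately have "AE t in lborel. indicator {0<..<T} t *\<^sub>R (?d t)\<^sup>2 = 0"
    unfolding set_lebesgue_integral_def by (subst (asm) integral_nonneg_eq_0_iff_AE) auto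
  then show ?thesis
    unfolding L2_eq_def by (rule AE_mp) (auto simp: indicator_def)
qed

lemma LINT_sum:
  fixes f :: "'i \<Rightarrow> 'a \<Rightarrow> real"
  assumes "\<And>i. i \<in> I \<Longrightarrow> set_integrable M A (f i)"
  shows "set_integrable M A (\<lambda>x. \<Sum>i\<in>I. f i x)"
    and "(LINT x:A|M. \<Sum>i\<in>I. f i x) = (\<Sum>i\<in>I. LINT x:A|M. f i x)"
  using assms unfolding set_integrable_def set_lebesgue_integral_def
  by (simp_all only: scaleR_sum_right Bochner_Integration.integrable_sum Bochner_Integration.integral_sum)

lemma mat_mult_vec_sum:
  assumes "A \<in> carrier_mat N N" "\<And>j. j \<in> J \<Longrightarrow> x j \<in> carrier_vec N" "i < N"
  shows "(A *\<^sub>v Matrix.vec N (\<lambda>i. \<Sum>j\<in>J. c j * x j $ i)) $ i =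
    (\<Sum>j\<in>J. c j * (A *\<^sub>v x j) $ (i::nat) :: real)"
proof -
  have "(A *\<^sub>v Matrix.vec N (\<lambda>i. \<Sum>j\<in>J. c j * x j $ i)) $ i
      = (\<Sum>n<N. \<Sum>j\<in>J. c j * (A $$ (i, n) * x j $ n))"
    using assms by (auto simp: scalar_prod_def sum_distrib_left lessThan_atLeast0 mult_ac intro!: sum.cong)
  also have "\<dots> = (\<Sum>j\<in>J. \<Sum>n<N. c j * (A $$ (i, n) * x j $ n))"
    by (rule sum.swap)
  also have "\<dots> = (\<Sum>j\<in>J. c j * (A *\<^sub>v x j) $ i)"
  proof (rule sum.cong)
    fix j assume "j \<in> J"
    then have "dim_vec (x j) = N"
      using assms(2) by auto
    then show "(\<Sum>n<N. c j * (A $$ (i, n) * x j $ n)) = c j * (A *\<^sub>v x j) $ i"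
      using assms by (auto simp: scalar_prod_def sum_distrib_left lessThan_atLeast0 intro!: sum.cong)
  qed simp
  finally show ?thesis .
qed

section \<open>The control operator and its adjoint\<close>

context krein_string begin

text \<open>
  The displacement at time \<open>t\<close> of the mass in component \<open>i\<close> after a unit impulse of the control at
  time \<open>0\<close>.
\<close>

definition impulse_response :: "nat \<Rightarrow> real \<Rightarrow> real" where
  "impulse_response i t = 1 / l 1 * (\<Sum>j=1..N. \<phi> j $ i * (sin (\<omega> j * t) / (\<omega> j * \<rho> j)))"

text \<open>
  The solution is assembled from one oscillator for each eigenvector, all driven by \<open>g\<close>, with weights
  \<open>1 / (l\<^sub>1 \<rho>\<^sub>j)\<close>. These weights are the right ones because \<open>\<Sum>\<^sub>j M \<phi>\<^sub>j / \<rho>\<^sub>j\<close> is the first unit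
  vector: this is the case \<open>k = 0\<close> of \<open>completeness\<close>, as \<open>\<phi> j $ 0 = 1\<close>.
\<close>

lemma solution_exists:
  assumes g: "g \<in> L2 T"
  shows "\<exists>u. is_solution N l m T g u"
proof -
  \<comment> \<open>The values of \<open>g\<close> at the end points are arbitrary; truncation makes \<open>g\<close> integrable on the closed
    interval.\<close>
  define g0 where "g0 t = indicator {0<..<T} t * g t" for t
  have g0: "set_integrable lborel {0..T} g0"
  proof -
    have "indicator {0..T} t *\<^sub>R g0 t = indicator {0<..<T} t *\<^sub>R g t" for t
      by (auto simp: g0_def indicator_def)
    then show ?thesis
      using L2_integrable[OF g] by (simp add: set_integrable_def)
  qed
  have "\<forall>j. \<exists>y v. y 0 = 0 \<and> v 0 = 0 \<and> continuous_on {0..T} y \<and>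
      (\<forall>t\<in>{0..T}. (y has_real_derivative v t) (at t within {0..T}) \<and>
         v t = (LINT s:{0..t}|lborel. g0 s - (\<omega> j)\<^sup>2 * y s))"
    by (intro allI oscillator_exists[OF g0])
  from choice[OF this] obtain Y where "\<forall>j. \<exists>v. Y j 0 = 0 \<and> v 0 = 0 \<and> continuous_on {0..T} (Y j) \<and>
      (\<forall>t\<in>{0..T}. (Y j has_real_derivative v t) (at t within {0..T}) \<and>
         v t = (LINT s:{0..t}|lborel. g0 s - (\<omega> j)\<^sup>2 * Y j s))" ..
  from choice[OF this] obtain V where YV: "\<And>j. Y j 0 = 0 \<and> V j 0 = 0 \<and> continuous_on {0..T} (Y j) \<and>
      (\<forall>t\<in>{0..T}. (Y j has_real_derivative V j t) (at t within {0..T}) \<and>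
         V j t = (LINT s:{0..t}|lborel. g0 s - (\<omega> j)\<^sup>2 * Y j s))"
    by blast
  have Y0: "Y j 0 = 0" and V0: "V j 0 = 0" and Yc: "continuous_on {0..T} (Y j)" for j
    using YV[of j] by simp_all
  have Y: "(Y j has_real_derivative V j t) (at t within {0..T})"
    and V: "V j t = (LINT s:{0..t}|lborel. g0 s - (\<omega> j)\<^sup>2 * Y j s)" if "t \<in> {0..T}" for j t
    using YV[of j] that by blast+
  define vc where "vc z = Matrix.vec N (\<lambda>i. \<Sum>j=1..N. (z j / (l 1 * \<rho> j)) * \<phi> j $ i)" for z :: "nat \<Rightarrow> real"
  have vc: "vc z $ i = (\<Sum>j=1..N. (z j / (l 1 * \<rho> j)) * \<phi> j $ i)" if "i < N" for z i
    using that by (simp add: vc_def)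
  have vc_carrier: "vc z \<in> carrier_vec N" for z
    by (simp add: vc_def)
  have vc_zero: "vc (\<lambda>_. 0) = 0\<^sub>v N"
    by (rule eq_vecI) (auto simp: vc_def)
  let ?u = "\<lambda>t. vc (\<lambda>j. Y j t)"
  let ?v = "\<lambda>t. vc (\<lambda>j. V j t)"
  let ?w = "\<lambda>t. vc (\<lambda>j. g0 t - (\<omega> j)\<^sup>2 * Y j t)"
  have hint: "set_integrable lborel {0..t} (\<lambda>s. g0 s - (\<omega> j)\<^sup>2 * Y j s)" if "t \<le> T" for j t
  proof (rule set_integrable_subset)
    show "set_integrable lborel {0..T} (\<lambda>s. g0 s - (\<omega> j)\<^sup>2 * Y j s)"
      by (intro set_integral_diff g0 borel_integrable_atLeastAtMost' continuous_intros Yc)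
  qed (use that in auto)
  have wint: "set_integrable lborel {0..t} (\<lambda>s. ?w s $ i)"
    and wval: "(LINT s:{0..t}|lborel. ?w s $ i) =
      (\<Sum>j=1..N. ((LINT s:{0..t}|lborel. g0 s - (\<omega> j)\<^sup>2 * Y j s) / (l 1 * \<rho> j)) * \<phi> j $ i)"
    if "t \<le> T" "i < N" for t i
    using hint[OF that(1)] unfolding vc[OF that(2)]
    by (simp_all add: LINT_sum divide_inverse)
  have ode: "mass_mat N m *\<^sub>v ?w t = string_mat N l *\<^sub>v ?u t + (g t / l 1) \<cdot>\<^sub>v unit_vec N 0"
    if t: "t \<in> {0<..<T}" for t
  proof (rule eq_vecI)
    fix i assume "i < dim_vec (string_mat N l *\<^sub>v ?u t + (g t / l 1) \<cdot>\<^sub>v unit_vec N 0)"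
    then have i: "i < N" by simp
    have "(mass_mat N m *\<^sub>v ?w t) $ i = m (i + 1) * ?w t $ i"
      by (rule mass_mat_mult_index[OF vc_carrier i])
    also have "\<dots> = (\<Sum>j=1..N. Y j t / (l 1 * \<rho> j) * (lam j * (m (i + 1) * \<phi> j $ i))
         + g t / l 1 * ((\<phi> j $ 0 * \<phi> j $ i / \<rho> j) * m (i + 1)))"
      unfolding vc[OF i] sum_distrib_left
    proof (rule sum.cong)
      fix j assume j: "j \<in> {1..N}"
      show "m (i + 1) * ((g0 t - (\<omega> j)\<^sup>2 * Y j t) / (l 1 * \<rho> j) * \<phi> j $ i)
        = Y j t / (l 1 * \<rho> j) * (lam j * (m (i + 1) * \<phi> j $ i))
         + g t / l 1 * ((\<phi> j $ 0 * \<phi> j $ i / \<rho> j) * m (i + 1))"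
        using t l1_pos \<rho>_pos[OF j] unfolding \<omega>_squared[OF j] first_component[OF j]
        by (simp add: g0_def field_simps)
    qed simp
    also have "\<dots> = (\<Sum>j=1..N. Y j t / (l 1 * \<rho> j) * (string_mat N l *\<^sub>v \<phi> j) $ i)
         + g t / l 1 * ((\<Sum>j=1..N. \<phi> j $ 0 * \<phi> j $ i / \<rho> j) * m (i + 1))"
      using i by (simp add: sum.distrib sum_distrib_left sum_distrib_right eigenvector_component del: index_mult_mat_vec)
    also have "\<dots> = (string_mat N l *\<^sub>v ?u t) $ i + g t / l 1 * (if i = 0 then 1 else 0)"
    proof -
      have "(string_mat N l *\<^sub>v ?u t) $ i = (\<Sum>j=1..N. Y j t / (l 1 * \<rho> j) * (string_mat N l *\<^sub>v \<phi> j) $ i)"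
        unfolding vc_def by (rule mat_mult_vec_sum) (use i eigenvector_carrier in simp_all)
      moreover have "(\<Sum>j=1..N. \<phi> j $ 0 * \<phi> j $ i / \<rho> j) * m (i + 1) = (if i = 0 then 1 else 0)"
        using completeness[of i 0] i N_pos by simp
      ultimately show ?thesis
        by (simp only:)
    qed
    finally show "(mass_mat N m *\<^sub>v ?w t) $ i = (string_mat N l *\<^sub>v ?u t + (g t / l 1) \<cdot>\<^sub>v unit_vec N 0) $ i"
      using i by (simp add: unit_vec_def del: index_mult_mat_vec)
  qed simp
  have "is_solution N l m T g ?u"
    unfolding is_solution_def
  proof (intro conjI, goal_cases)
    case 3
    show ?case
    proof (rule exI[of _ ?v], rule exI[of _ ?w], intro conjI ballI allI impI)
      show "?v 0 = 0\<^sub>v N"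
        by (simp add: V0 vc_zero)
      fix i assume i: "i < N"
      show "set_integrable lborel {0..T} (\<lambda>t. ?w t $ i)"
        by (rule wint[OF order_refl i])
      fix t assume t: "t \<in> {0..T}"
      show "((\<lambda>s. ?u s $ i) has_real_derivative ?v t $ i) (at t within {0..T})"
        unfolding vc[OF i] by (intro DERIV_sum DERIV_cmult_right DERIV_cdivide Y[OF t])
      show "?v t $ i = (LINT s:{0..t}|lborel. ?w s $ i)"
        using wval[of t i] t i by (simp only: vc[OF i] V[OF t] atLeastAtMost_iff simp_thms)
    next
      show "AE t in lborel. t \<in> {0<..<T} \<longrightarrow>
         mass_mat N m *\<^sub>v ?w t = string_mat N l *\<^sub>v ?u t + (g t / l 1) \<cdot>\<^sub>v unit_vec N 0"
        by (intro AE_I2 impI ode)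
    qed (rule vc_carrier)+
  qed (simp_all add: Y0 vc_zero vc_carrier)
  then show ?thesis
    by (rule exI[of _ ?u])
qed

text \<open>
  Taking the product with \<open>\<phi>\<^sub>j\<close> decouples the system, as the stiffness matrix is symmetric: the
  projection \<open>y = (M u, \<phi>\<^sub>j)\<close> satisfies \<open>y'' = \<lambda>\<^sub>j y + g / l\<^sub>1\<close>.
\<close>

lemma solution_modal_component:
  assumes T: "T > 0" and g: "g \<in> L2 T" and sol: "is_solution N l m T g u" and j: "j \<in> {1..N}"
  shows "(\<Sum>i<N. m (i + 1) * \<phi> j $ i * u T $ i)
    = (LINT s:{0<..<T}|lborel. g s / l 1 * (sin (\<omega> j * (T - s)) / \<omega> j))"
proof -
  obtain v w where uc: "\<And>t. t \<in> {0..T} \<Longrightarrow> u t \<in> carrier_vec N" and u0: "u 0 = 0\<^sub>v N"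
    and wc: "\<And>t. t \<in> {0..T} \<Longrightarrow> w t \<in> carrier_vec N"
    and wint: "\<And>i. i < N \<Longrightarrow> set_integrable lborel {0..T} (\<lambda>t. w t $ i)"
    and ud: "\<And>i t. i < N \<Longrightarrow> t \<in> {0..T} \<Longrightarrow>
       ((\<lambda>s. u s $ i) has_real_derivative v t $ i) (at t within {0..T})"
    and vint: "\<And>i t. i < N \<Longrightarrow> t \<in> {0..T} \<Longrightarrow> v t $ i = (LINT s:{0..t}|lborel. w s $ i)"
    and ode: "AE t in lborel. t \<in> {0<..<T} \<longrightarrow>
           mass_mat N m *\<^sub>v w t = string_mat N l *\<^sub>v u t + (g t / l 1) \<cdot>\<^sub>v unit_vec N 0"
    using sol unfolding is_solution_def by blast
  define M where "M x = (\<Sum>i<N. m (i + 1) * \<phi> j $ i * x $ i)" for x :: "real Matrix.vec"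
  \<comment> \<open>The equation holds only almost everywhere. Replacing \<open>M (w t)\<close> by \<open>h\<close> makes it hold
    identically without changing the integral \<open>M (v t)\<close>.\<close>
  define h where "h t = indicator {0<..<T} t * (g t / l 1) - (\<omega> j)\<^sup>2 * M (u t)" for t
  have yd: "((\<lambda>s. M (u s)) has_real_derivative M (v t)) (at t within {0..T})" if t: "t \<in> {0..T}" for t
    unfolding M_def using t by (intro DERIV_sum DERIV_cmult ud) auto
  have yc: "continuous_on {0..T} (\<lambda>t. M (u t))"
    by (rule DERIV_continuous_on) (rule yd)
  have g0: "set_integrable lborel {0..T} (\<lambda>t. indicator {0<..<T} t * (g t / l 1))"
  proof -
    have "indicator {0..T} t *\<^sub>R (indicator {0<..<T} t * (g t / l 1)) = (indicator {0<..<T} t *\<^sub>R g t) / l 1" for t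
      by (auto simp: indicator_def)
    moreover have "integrable lborel (\<lambda>t. (indicator {0<..<T} t *\<^sub>R g t) / l 1)"
      using L2_integrable[OF g] by (simp add: set_integrable_def)
    ultimately show ?thesis
      unfolding set_integrable_def by presburger
  qed
  have hint: "set_integrable lborel {0..T} h"
    unfolding h_def
    by (intro set_integral_diff g0 borel_integrable_atLeastAtMost' continuous_intros yc)
  have AE_h: "AE t in lborel. t \<in> {0<..<T} \<longrightarrow> M (w t) = h t"
    using ode
  proof (rule AE_mp, intro AE_I2 impI)
    fix t assume t: "t \<in> {0<..<T}" and *: "t \<in> {0<..<T} \<longrightarrow>
           mass_mat N m *\<^sub>v w t = string_mat N l *\<^sub>v u t + (g t / l 1) \<cdot>\<^sub>v unit_vec N 0"
    then have eq: "mass_mat N m *\<^sub>v w t = string_mat N l *\<^sub>v u t + (g t / l 1) \<cdot>\<^sub>v unit_vec N 0"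
      by simp
    have t': "t \<in> {0..T}" using t by auto
    note [simp] = eigenvector_carrier[OF j] uc[OF t'] wc[OF t']
    have Mx: "M x = \<phi> j \<bullet> (mass_mat N m *\<^sub>v x)" if "x \<in> carrier_vec N" for x
      using that by (auto simp: M_def scalar_prod_def mass_mat_mult_index lessThan_atLeast0
          simp del: index_mult_mat_vec intro!: sum.cong)
    have c: "string_mat N l *\<^sub>v u t \<in> carrier_vec N" "mass_mat N m *\<^sub>v \<phi> j \<in> carrier_vec N"
      by (rule mult_mat_vec_carrier[of _ N N]; simp)+
    have "M (w t) = \<phi> j \<bullet> (string_mat N l *\<^sub>v u t) + g t / l 1 * (\<phi> j \<bullet> unit_vec N 0)"
      using c by (simp add: Mx eq scalar_prod_add_distrib[of _ N])
    also have "\<phi> j \<bullet> (string_mat N l *\<^sub>v u t) = lam j * ((mass_mat N m *\<^sub>v \<phi> j) \<bullet> u t)"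
      using c by (simp flip: string_mat_self_adjoint add: eigenvector_eq[OF j])
    also have "(mass_mat N m *\<^sub>v \<phi> j) \<bullet> u t = M (u t)"
      by (simp add: Mx mass_mat_self_adjoint[of _ N])
    also have "\<phi> j \<bullet> unit_vec N 0 = 1"
      using N_pos first_component[OF j] by simp
    finally show "M (w t) = h t"
      using t \<omega>_squared[OF j] by (simp add: h_def)
  qed
  have vh: "M (v t) = (LINT s:{0..t}|lborel. h s)" if t: "t \<in> {0..T}" for t
  proof -
    have wt: "integrable lborel (\<lambda>s. indicator {0..t} s *\<^sub>R w s $ i)" if "i < N" for i
      using set_integrable_subset[OF wint[OF that], of "{0..t}"] t by (auto simp: set_integrable_def)
    have wt': "integrable lborel (\<lambda>s. \<Sum>i<N. m (i + 1) * \<phi> j $ i * (indicator {0..t} s *\<^sub>R w s $ i))"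
      by (intro Bochner_Integration.integrable_sum integrable_mult_right wt) auto
    have ht: "integrable lborel (\<lambda>s. indicator {0..t} s *\<^sub>R h s)"
      using set_integrable_subset[OF hint, of "{0..t}"] t by (auto simp: set_integrable_def)
    have "M (v t) = (\<Sum>i<N. m (i + 1) * \<phi> j $ i * (\<integral>s. indicator {0..t} s *\<^sub>R w s $ i \<partial>lborel))"
      using vint t by (simp add: M_def set_lebesgue_integral_def)
    also have "\<dots> = (\<integral>s. (\<Sum>i<N. m (i + 1) * \<phi> j $ i * (indicator {0..t} s *\<^sub>R w s $ i)) \<partial>lborel)"
    proof -
      have "integrable lborel (\<lambda>s. m (i + 1) * \<phi> j $ i * (indicator {0..t} s *\<^sub>R w s $ i))"
        if "i \<in> {..<N}" for i
        using that by (intro integrable_mult_right wt) simp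
      from Bochner_Integration.integral_sum[where I = "{..<N}"
          and f = "\<lambda>i s. m (i + 1) * \<phi> j $ i * (indicator {0..t} s *\<^sub>R w s $ i)", OF this]
      show ?thesis
        by (simp only: integral_mult_right_zero)
    qed
    also have "\<dots> = (\<integral>s. indicator {0..t} s *\<^sub>R h s \<partial>lborel)"
    proof (rule integral_cong_AE)
      show "AE s in lborel. (\<Sum>i<N. m (i + 1) * \<phi> j $ i * (indicator {0..t} s *\<^sub>R w s $ i))
         = indicator {0..t} s *\<^sub>R h s"
        using AE_h AE_lborel_singleton[of 0] AE_lborel_singleton[of T]
      proof eventually_elim
        case (elim s)
        then have "s \<in> {0..t} \<Longrightarrow> M (w s) = h s"
          using t by auto
        then show ?case
          by (auto simp: indicator_def M_def)
      qed
    qed (use wt' ht in auto)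
    finally show ?thesis by (simp add: set_lebesgue_integral_def)
  qed
  have "M (u T) = (LINT s:{0..T}|lborel. (h s + (\<omega> j)\<^sup>2 * M (u s)) * (sin (\<omega> j * (T - s)) / \<omega> j))"
    by (rule LINT_oscillator[OF _ \<omega>_nonzero[OF j] hint yd _ vh]) (use T u0 in \<open>auto simp: M_def\<close>)
  also have "\<dots> = (LINT s:{0<..<T}|lborel. g s / l 1 * (sin (\<omega> j * (T - s)) / \<omega> j))"
    unfolding set_lebesgue_integral_def h_def
    by (rule Bochner_Integration.integral_cong) (auto simp: indicator_def)
  finally show ?thesis by (simp add: M_def)
qed

lemma solution_at_T:
  assumes T: "T > 0" and g: "g \<in> L2 T" and sol: "is_solution N l m T g u" and k: "k < N"
  shows "u T $ k = L2_inner T (\<lambda>t. impulse_response k (T - t)) g"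
proof -
  have s_int: "set_integrable lborel {0<..<T} (\<lambda>s. g s / l 1 * (sin (\<omega> j * (T - s)) / \<omega> j))" if "j \<in> {1..N}" for j
  proof -
    have "(\<lambda>s. sin (\<omega> j * (T - s)) / \<omega> j / l 1) \<in> L2 T"
      using \<omega>_nonzero[OF that] l1_pos by (intro L2_continuous continuous_intros) auto
    from L2_product_integrable[OF g this] show ?thesis
      by (simp add: mult_ac)
  qed
  have "u T $ k = (\<Sum>i<N. (if i = k then 1 else 0) * u T $ i)"
    using k by (simp add: if_distrib if_distribR cong: if_cong)
  also have "\<dots> = (\<Sum>i<N. \<Sum>j=1..N. \<phi> j $ k / \<rho> j * (m (i + 1) * \<phi> j $ i * u T $ i))"
    using k by (intro sum.cong) (auto simp: completeness[symmetric] sum_distrib_right sum_distrib_left mult_ac)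
  also have "\<dots> = (\<Sum>j=1..N. \<phi> j $ k / \<rho> j * (\<Sum>i<N. m (i + 1) * \<phi> j $ i * u T $ i))"
    by (subst sum.swap) (simp add: sum_distrib_left)
  also have "\<dots> = (\<Sum>j=1..N. LINT s:{0<..<T}|lborel. \<phi> j $ k / \<rho> j * (g s / l 1 * (sin (\<omega> j * (T - s)) / \<omega> j)))"
    by (intro sum.cong refl) (simp only: solution_modal_component[OF T g sol] set_integral_mult_right)
  also have "\<dots> = (LINT s:{0<..<T}|lborel. \<Sum>j=1..N. \<phi> j $ k / \<rho> j * (g s / l 1 * (sin (\<omega> j * (T - s)) / \<omega> j)))"
    by (rule LINT_sum(2)[symmetric]) (intro set_integrable_mult_right s_int)
  also have "\<dots> = L2_inner T (\<lambda>t. impulse_response k (T - t)) g"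
    unfolding L2_inner_def impulse_response_def
    by (intro arg_cong[where f = "set_lebesgue_integral lborel {0<..<T}"] ext)
       (simp add: sum_distrib_left sum_distrib_right mult_ac)
  finally show ?thesis .
qed

lemma control_op_component:
  assumes "T > 0" "g \<in> L2 T" "k < N"
  shows "control_op N l m T g $ k = L2_inner T (\<lambda>t. impulse_response k (T - t)) g"
  unfolding control_op_def string_sol_def
  by (rule solution_at_T[OF assms(1,2) someI_ex[OF solution_exists[OF assms(2)]] assms(3)])

lemma control_op_carrier:
  assumes "T > 0" "g \<in> L2 T"
  shows "control_op N l m T g \<in> carrier_vec N"
proof -
  have "is_solution N l m T g (string_sol N l m T g)"
    unfolding string_sol_def by (rule someI_ex[OF solution_exists[OF assms(2)]])
  then have "\<forall>t\<in>{0..T}. string_sol N l m T g t \<in> carrier_vec N"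
    unfolding is_solution_def by blast
  then show ?thesis
    using assms(1) by (simp add: control_op_def)
qed

lemma target_state_inner:
  assumes k: "k \<in> {1..N}" and x: "x \<in> carrier_vec N"
  shows "state_inner N m (target_state N m k) x = x $ (k - 1)"
proof -
  have "m k > 0" using m_pos k by auto
  have "state_inner N m (target_state N m k) x = (\<Sum>i<N. m (i + 1) * target_state N m k $ i * x $ i)"
    by (rule state_inner_sum) (simp_all add: target_state_def x)
  also have "\<dots> = (\<Sum>i<N. if i = k - 1 then m (i + 1) * (1 / m k) * x $ i else 0)"
    using k by (intro sum.cong) (auto simp: target_state_def unit_vec_def)
  also have "\<dots> = x $ (k - 1)"
  proof -
    have "k - 1 \<in> {..<N}" "k - 1 + 1 = k" using k by auto
    then show ?thesis
      using \<open>m k > 0\<close> by (simp only: sum.delta finite_lessThan if_True) simp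
  qed
  finally show ?thesis .
qed

text \<open>
  Both functions represent the functional \<open>g \<mapsto> (u\<^sup>g(T))\<^sub>k\<close>, so they agree up to null sets.
\<close>

lemma control_op_adj_target:
  assumes T: "T > 0" and k: "k \<in> {1..N}"
  shows "L2_eq T (control_op_adj N l m T (target_state N m k)) (\<lambda>t. impulse_response (k - 1) (T - t))"
proof -
  let ?c = "\<lambda>t. impulse_response (k - 1) (T - t)"
  define P where "P h \<longleftrightarrow> h \<in> L2 T \<and>
     (\<forall>g\<in>L2 T. L2_inner T h g = state_inner N m (target_state N m k) (control_op N l m T g))" for h
  have "k - 1 < N" using k by auto
  have W: "state_inner N m (target_state N m k) (control_op N l m T g) = L2_inner T ?c g" if "g \<in> L2 T" for g
    using that
    by (simp only: target_state_inner[OF k control_op_carrier[OF T]] control_op_component[OF T _ \<open>k - 1 < N\<close>])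
  have "continuous_on {0..T} ?c"
  proof -
    have "\<omega> j * \<rho> j \<noteq> 0" if "j \<in> {1..N}" for j
      using \<omega>_nonzero[OF that] \<rho>_pos[OF that] by simp
    then show ?thesis
      unfolding impulse_response_def by (intro continuous_intros ballI)
  qed
  then have c: "?c \<in> L2 T"
    by (rule L2_continuous)
  then have "P ?c" by (simp add: P_def W)
  then have "P (SOME h. P h)"
    by (rule someI[of P])
  moreover have "(SOME h. P h) = control_op_adj N l m T (target_state N m k)"
    unfolding P_def control_op_adj_def ..
  ultimately have "P (control_op_adj N l m T (target_state N m k))"
    by simp
  then show ?thesis
    unfolding P_def by (intro L2_eqI[OF _ c]) (simp_all add: W)
qed

end

section \<open>The equations for the controls\<close>

theorem theorem5:
  fixes N :: nat and T :: real
    and l m lam :: "nat \<Rightarrow> real"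
    and \<phi> :: "nat \<Rightarrow> real Matrix.vec"
    and f :: "nat \<Rightarrow> real \<Rightarrow> real"
  assumes "N \<ge> 2" and "T > 0"
    and "\<forall>i\<in>{1..N+1}. l i > 0" and "\<forall>i\<in>{1..N}. m i > 0"
    and "spectral_data N l m lam \<phi>"
    and "\<forall>k\<in>{1..N}. f k \<in> F1 N T lam \<and> control_op N l m T (f k) = target_state N m k"
  shows "\<exists>c :: nat \<Rightarrow> real \<Rightarrow> real.
    (\<forall>k\<in>{1..N}. L2_eq T (connecting_op N l m T (f k)) (c k)) \<and>
    (\<forall>t\<in>{0<..<T}. c 1 t = response N l m lam \<phi> (T - t)) \<and>
    (\<forall>k\<in>{1..N}. \<forall>t\<in>{0<..<T}. c k field_differentiable at t \<and> deriv (c k) field_differentiable at t) \<and>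
    (\<forall>t\<in>{0<..<T}.
       m 1 * deriv (deriv (c 1)) t = coeff_b l 1 * c 1 t + coeff_a l 1 * c 2 t \<and>
       (\<forall>k\<in>{2..N-1}. m k * deriv (deriv (c k)) t =
          coeff_a l (k - 1) * c (k - 1) t + coeff_b l k * c k t + coeff_a l k * c (k + 1) t) \<and>
       m N * deriv (deriv (c N)) t = coeff_a l (N - 1) * c (N - 1) t + coeff_b l N * c N t)"
proof -
  interpret krein_string N l m lam \<phi>
    by (rule krein_string.intro) (use assms(1) in simp, fact+)
  define c where "c k t = impulse_response (k - 1) (T - t)" for k t
  define c1 where "c1 k t = 1 / l 1 * (\<Sum>j=1..N. \<phi> j $ (k - 1) * (- cos (\<omega> j * (T - t)) / \<rho> j))" for k t
  \<comment> \<open>The time factor of mode \<open>j\<close> is common to all \<open>c k\<close>, so identities among the components of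
    \<open>\<phi> j\<close> carry over to the functions \<open>c k\<close>.\<close>
  define s where "s j t = 1 / l 1 * (sin (\<omega> j * (T - t)) / (\<omega> j * \<rho> j))" for j t
  define c2 where "c2 k t = (\<Sum>j=1..N. lam j * \<phi> j $ (k - 1) * s j t)" for k t
  have c_s: "c k t = (\<Sum>j=1..N. \<phi> j $ (k - 1) * s j t)" for k t
    unfolding c_def impulse_response_def s_def sum_distrib_left by (rule sum.cong) simp_all
  have d1: "(c k has_field_derivative c1 k t) (at t)" for k t
    unfolding c_def [abs_def] impulse_response_def c1_def
  proof (intro DERIV_cmult DERIV_sum)
    fix j assume j: "j \<in> {1..N}"
    show "((\<lambda>t. sin (\<omega> j * (T - t)) / (\<omega> j * \<rho> j)) has_field_derivative
        - cos (\<omega> j * (T - t)) / \<rho> j) (at t)"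
      using \<omega>_nonzero[OF j] \<rho>_pos[OF j] by (auto intro!: derivative_eq_intros simp: field_simps)
  qed
  have d2: "(c1 k has_field_derivative c2 k t) (at t)" for k t
  proof -
    have "(c1 k has_field_derivative 1 / l 1 * (\<Sum>j=1..N. \<phi> j $ (k - 1) * (- \<omega> j * sin (\<omega> j * (T - t)) / \<rho> j))) (at t)"
      unfolding c1_def [abs_def]
    proof (intro DERIV_cmult DERIV_sum)
      fix j assume j: "j \<in> {1..N}"
      show "((\<lambda>t. - cos (\<omega> j * (T - t)) / \<rho> j) has_field_derivative
          - \<omega> j * sin (\<omega> j * (T - t)) / \<rho> j) (at t)"
        using \<rho>_pos[OF j] by (auto intro!: derivative_eq_intros)
    qed
    also have "1 / l 1 * (\<Sum>j=1..N. \<phi> j $ (k - 1) * (- \<omega> j * sin (\<omega> j * (T - t)) / \<rho> j)) = c2 k t"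
      unfolding c2_def sum_distrib_left
    proof (rule sum.cong)
      fix j assume j: "j \<in> {1..N}"
      have "1 / L * (p * (- w * S / r)) = - w\<^sup>2 * p * (1 / L * (S / (w * r)))" if "w \<noteq> 0"
        for w L p S r :: real
        using that by (simp add: power2_eq_square)
      from this[OF \<omega>_nonzero[OF j]]
      show "1 / l 1 * (\<phi> j $ (k - 1) * (- \<omega> j * sin (\<omega> j * (T - t)) / \<rho> j)) = lam j * \<phi> j $ (k - 1) * s j t"
        unfolding s_def \<omega>_squared[OF j] by (simp only: minus_minus)
    qed simp
    finally show ?thesis .
  qed
  have deriv_c: "deriv (c k) = c1 k" "deriv (c1 k) = c2 k" for k
    by (rule ext, rule DERIV_imp_deriv, rule d1) (rule ext, rule DERIV_imp_deriv, rule d2)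
  have system: "m k * c2 k t = (\<Sum>j=1..N. (string_mat N l *\<^sub>v \<phi> j) $ (k - 1) * s j t)" if "k \<in> {1..N}" for k t
  proof -
    have "(string_mat N l *\<^sub>v \<phi> j) $ (k - 1) = lam j * (m k * \<phi> j $ (k - 1))" if "j \<in> {1..N}" for j
      using eigenvector_component[OF that, of "k - 1"] \<open>k \<in> {1..N}\<close> by (cases k) auto
    then show ?thesis
      unfolding c2_def sum_distrib_left by (intro sum.cong refl) (simp only: mult_ac)
  qed
  have expand: "(\<Sum>j=1..N. (string_mat N l *\<^sub>v \<phi> j) $ (k - 1) * s j t) =
     (if k = 1 then 0 else coeff_a l (k - 1) * c (k - 1) t) + coeff_b l k * c k t
       + (if k = N then 0 else coeff_a l k * c (k + 1) t)" if "k \<in> {1..N}" for k t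
  proof -
    have "(\<Sum>j=1..N. (string_mat N l *\<^sub>v \<phi> j) $ (k - 1) * s j t) =
      (\<Sum>j=1..N. (if k = 1 then 0 else coeff_a l (k - 1) * (\<phi> j $ (k - 1 - 1) * s j t))
        + coeff_b l k * (\<phi> j $ (k - 1) * s j t)
        + (if k = N then 0 else coeff_a l k * (\<phi> j $ (k + 1 - 1) * s j t)))"
      using that by (intro sum.cong refl)
       (auto simp: string_mat_mult_index[OF eigenvector_carrier] algebra_simps simp del: index_mult_mat_vec)
    then show ?thesis
      by (simp add: sum.distrib c_s sum_distrib_left)
  qed
  show ?thesis
  proof (intro exI[of _ c] conjI ballI)
    fix k assume "k \<in> {1..N}"
    then show "L2_eq T (connecting_op N l m T (f k)) (c k)"
      using assms(6) control_op_adj_target[OF assms(2)]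
      by (simp add: connecting_op_def c_def [abs_def])
  next
    fix t
    show "c 1 t = response N l m lam \<phi> (T - t)"
      by (simp add: c_def impulse_response_def response_def first_component)
  next
    fix k t
    show "c k field_differentiable at t" "deriv (c k) field_differentiable at t"
      using d1 d2 unfolding deriv_c field_differentiable_def by blast+
  next
    fix t
    show "m 1 * deriv (deriv (c 1)) t = coeff_b l 1 * c 1 t + coeff_a l 1 * c 2 t"
      using assms(1) system[of 1 t] expand[of 1 t] by (simp add: deriv_c numeral_2_eq_2)
    show "m N * deriv (deriv (c N)) t = coeff_a l (N - 1) * c (N - 1) t + coeff_b l N * c N t"
      using assms(1) system[of N t] expand[of N t] by (simp add: deriv_c)
    show "m k * deriv (deriv (c k)) t =
          coeff_a l (k - 1) * c (k - 1) t + coeff_b l k * c k t + coeff_a l k * c (k + 1) t"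
      if "k \<in> {2..N-1}" for k
    proof -
      have "k \<in> {1..N}" "k \<noteq> 1" "k \<noteq> N"
        using that by auto
      then show ?thesis
        using system[of k t] expand[of k t] by (simp only: deriv_c if_False)
    qed
  qed
qed

end
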